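(* Let $(X,\mathcal{R})$ be an association scheme with $d$ classes, adjacency matrices $A_0,\ldots,A_d$ and intersection numbers $p_{i,j}^k$, and let $F\subset\{1,2,\ldots,d\}$. Let $D$ be the directed graph with adjacency matrix $\sum_{f\in F}A_f$. Then $D$ is a directed Deza graph if and only if $$\sum_{f,g\in F}p_{f,g}^k$$ takes on at most two values as $k$ ranges over $\{1,\ldots,d\}$.
   Context: Association scheme: let $X$ be a finite set of size $n$ and $\mathcal{R}=\{R_0,\ldots,R_d\}$ relations on $X$, and let $A_i$ be the $(0,1)$-matrix with $[A_i]_{xy}=1$ iff $(x,y)\in R_i$. The pair $(X,\mathcal{R})$ is an association scheme with $d$ classes if: (1) $A_0=I$; (2) $\sum_{i=0}^dA_i=J$ (the all-ones matrix); (3) $A_i^t\in\{A_0,\ldots,A_d\}$ for all $i$; (4) for all $i,j,k\in\{0,\ldots,d\}$ there are non-negative integers $p_{i,j}^k$ with $A_iA_j=\sum_{k=0}^dp_{i,j}^kA_k$; (5) $A_iA_j=A_jA_i$ for all $i,j$. The scheme is not assumed symmetric. Digraphs have no loops and at most one arc from one vertex to another. Write $u\rightarrow v$ if there is an arc from $u$ to $v$. Two vertices $u,v$ are called adjacent if $u\rightarrow v$ and $v\rightarrow u$. The adjacency matrix of a digraph has $(i,j)$-entry $1$ iff $i\rightarrow j$, and $0$ otherwise. Let $n,k,b,a,t$ be integers with $0\le a\le b\le k\le n$ and $0\le t\le k$. A digraph $D=(V,A)$ is a directed $(n,k,b,a,t)$-Deza graph if: (1) $|V|=n$; (2) every vertex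 has in-degree and out-degree $k$ and is adjacent to exactly $t$ vertices; (3) for any distinct vertices $u,v$, the number of vertices $w$ with $u\rightarrow w\rightarrow v$ is $a$ or $b$. A directed Deza graph is a directed $(n,k,b,a,t)$-Deza graph for some such parameters. *)

theory Defs
  imports "HOL-Analysis.Analysis" "Graph_Theory.Pair_Digraph"
begin

text \<open>
  The finite ground set \<open>X\<close> is the universe of a type \<open>'x\<close> of class \<open>finite\<close>, so that
  matrices with rows and columns indexed by \<open>X\<close> are elements of \<open>real ^ 'x ^ 'x\<close>.
\<close>

definition relation_matrix :: "'x rel \<Rightarrow> real ^ 'x::finite ^ 'x" where
  "relation_matrix r = (\<chi> x y. if (x, y) \<in> r then 1 else 0)"

definition intersection_numbers ::
  "nat \<Rightarrow> (nat \<Rightarrow> ('x::finite) rel) \<Rightarrow> (nat \<Rightarrow> nat \<Rightarrow> nat \<Rightarrow> nat) \<Rightarrow> bool" where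
  "intersection_numbers d R p \<longleftrightarrow>
     (\<forall>i\<le>d. \<forall>j\<le>d. relation_matrix (R i) ** relation_matrix (R j) =
        (\<Sum>k\<le>d. real (p i j k) *\<^sub>R relation_matrix (R k)))"

text \<open>
  Here \<open>p i j k\<close> stands for the number written with lower indices \<open>i\<close>, \<open>j\<close> and upper index
  \<open>k\<close>. The relations of a scheme are required to be nonempty, as is standard: together with the
  condition that the matrices add up to the all-ones matrix, this makes them linearly
  independent, so that \<open>p i j k\<close> is determined by the scheme for \<open>i, j, k \<le> d\<close>. The scheme is
  commutative but not necessarily symmetric.
\<close>

definition association_scheme :: "nat \<Rightarrow> (nat \<Rightarrow> ('x::finite) rel) \<Rightarrow> bool" where
  "association_scheme d R \<longleftrightarrow>
     (\<forall>i\<le>d. R i \<noteq> {}) \<and>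
     relation_matrix (R 0) = mat 1 \<and>
     (\<Sum>i\<le>d. relation_matrix (R i)) = (\<chi> x y. 1) \<and>
     (\<forall>i\<le>d. \<exists>j\<le>d. transpose (relation_matrix (R i)) = relation_matrix (R j)) \<and>
     (\<exists>p. intersection_numbers d R p) \<and>
     (\<forall>i\<le>d. \<forall>j\<le>d. relation_matrix (R i) ** relation_matrix (R j) =
        relation_matrix (R j) ** relation_matrix (R i))"

text \<open>
  The locale \<open>pair_digraph\<close> (finite, no loops, arcs are pairs of vertices) provides digraphs
  without loops and with at most one arc from one vertex to another; arcs in both directions
  between two vertices are possible, and the parameter \<open>t\<close> below counts these.
\<close>

definition deza_digraph_with ::
  "nat \<Rightarrow> nat \<Rightarrow> nat \<Rightarrow> nat \<Rightarrow> nat \<Rightarrow> 'x pair_pre_digraph \<Rightarrow> bool" where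
  "deza_digraph_with n k b a t D \<longleftrightarrow>
     a \<le> b \<and> b \<le> k \<and> k \<le> n \<and> t \<le> k \<and>
     pair_digraph D \<and>
     card (pverts D) = n \<and>
     (\<forall>v\<in>pverts D. in_degree D v = k \<and> out_degree D v = k \<and>
        card {u \<in> pverts D. (u, v) \<in> parcs D \<and> (v, u) \<in> parcs D} = t) \<and>
     (\<forall>u\<in>pverts D. \<forall>v\<in>pverts D. u \<noteq> v \<longrightarrow>
        card {w \<in> pverts D. (u, w) \<in> parcs D \<and> (w, v) \<in> parcs D} \<in> {a, b})"

definition deza_digraph :: "'x pair_pre_digraph \<Rightarrow> bool" where
  "deza_digraph D \<longleftrightarrow> (\<exists>n k b a t. deza_digraph_with n k b a t D)"

text \<open>The adjacency matrix of a digraph whose vertex set is the whole type.\<close>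

definition digraph_matrix :: "('x::finite) pair_pre_digraph \<Rightarrow> real ^ 'x ^ 'x" where
  "digraph_matrix D = relation_matrix (parcs D)"

end

theory Submission
  imports Defs
begin

text \<open>
  Write \<open>E\<close> for the arc set of \<open>D\<close> and \<open>A\<close> for its adjacency matrix. Since the matrices of the
  scheme are the indicators of a partition of \<open>X \<times> X\<close>, the coefficient of \<open>A\<^sub>k\<close> in \<open>A\<^sup>2\<close> is the
  number of walks of length two in \<open>D\<close> between any two points related by \<open>R\<^sub>k\<close>. For \<open>k \<ge> 1\<close> this
  is the Deza condition, and for \<open>k = 0\<close> it says that every vertex lies on the same number of
  two-way arcs. The converse of \<open>E\<close> is again a union of relations of the scheme, so the
  coefficients of \<open>A\<^sub>0\<close> in the products of \<open>A\<close> with its transpose, which are the out-degrees and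
  the in-degrees, are constant as well; they agree because the scheme is commutative.
\<close>

section \<open>Relation matrices and walks of length two\<close>

lemma relation_matrix_nth [simp]:
  "relation_matrix r $ x $ y = (if (x, y) \<in> r then 1 else 0)"
  by (simp add: relation_matrix_def)

lemma relation_matrix_eq_iff: "relation_matrix r = relation_matrix s \<longleftrightarrow> r = s"
  by (auto simp: vec_eq_iff split: if_splits)

lemma relation_matrix_mult_nth:
  "(relation_matrix r ** relation_matrix s) $ x $ y = real (card {w. (x, w) \<in> r \<and> (w, y) \<in> s})"
proof -
  have "(\<Sum>w\<in>UNIV. (if (x, w) \<in> r then 1 else 0) * (if (w, y) \<in> s then 1 else 0) :: real)
      = (\<Sum>w\<in>UNIV. if (x, w) \<in> r \<and> (w, y) \<in> s then 1 else 0)"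
    by (rule sum.cong) auto
  then show ?thesis
    by (simp add: matrix_matrix_mult_def sum.If_cases)
qed

text \<open>By disjointness each middle point \<open>w\<close> determines the pair
  \<open>(f, g)\<close> of relations used by its two steps, so the walks split into disjoint classes
  indexed by \<open>F \<times> G\<close>.\<close>

lemma card_relcomp_Union:
  fixes R :: "'i \<Rightarrow> ('x::finite) rel"
  assumes "finite F" "finite G"
    and "disjoint_family_on R F" "disjoint_family_on R G"
  shows "card {w. (x, w) \<in> (\<Union>f\<in>F. R f) \<and> (w, y) \<in> (\<Union>g\<in>G. R g)} =
    (\<Sum>f\<in>F. \<Sum>g\<in>G. card {w. (x, w) \<in> R f \<and> (w, y) \<in> R g})"
proof -
  have "{w. (x, w) \<in> (\<Union>f\<in>F. R f) \<and> (w, y) \<in> (\<Union>g\<in>G. R g)} =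
      (\<Union>(f, g)\<in>F \<times> G. {w. (x, w) \<in> R f \<and> (w, y) \<in> R g})"
    by auto
  also have "card \<dots> = (\<Sum>(f, g)\<in>F \<times> G. card {w. (x, w) \<in> R f \<and> (w, y) \<in> R g})"
  proof (subst card_UN_disjoint)
    show "\<forall>h\<in>F \<times> G. \<forall>h'\<in>F \<times> G. h \<noteq> h' \<longrightarrow>
        (case h of (f, g) \<Rightarrow> {w. (x, w) \<in> R f \<and> (w, y) \<in> R g}) \<inter>
        (case h' of (f, g) \<Rightarrow> {w. (x, w) \<in> R f \<and> (w, y) \<in> R g}) = {}"
      using assms(3,4) unfolding disjoint_family_on_def by blast
  qed (use assms(1,2) in \<open>simp_all add: case_prod_unfold\<close>)
  finally show ?thesis
    by (simp add: sum.cartesian_product)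
qed

section \<open>The scheme as a partition of the pairs of points\<close>

context
  fixes d :: nat and R :: "nat \<Rightarrow> ('x::finite) rel"
  assumes scheme: "association_scheme d R"
begin

lemma scheme_nonempty: "i \<le> d \<Longrightarrow> R i \<noteq> {}"
  using scheme by (simp add: association_scheme_def)

lemma scheme_0: "R 0 = Id"
proof -
  have "relation_matrix (R 0) = relation_matrix (Id :: 'x rel)"
    using scheme by (simp add: association_scheme_def mat_def relation_matrix_def)
  then show ?thesis
    by (simp add: relation_matrix_eq_iff)
qed

text \<open>The cardinality is the entry at \<open>(x, y)\<close> of the sum of all scheme matrices,
  which is the all-ones matrix.\<close>

lemma scheme_card: "card {i. i \<le> d \<and> (x, y) \<in> R i} = 1"
proof -
  have "(\<Sum>i\<le>d. relation_matrix (R i)) $ x $ y = 1"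
    using scheme by (simp add: association_scheme_def)
  moreover have "{..d} \<inter> {i. (x, y) \<in> R i} = {i. i \<le> d \<and> (x, y) \<in> R i}"
    by auto
  ultimately show ?thesis
    by (simp add: sum.If_cases)
qed

lemma scheme_cover:
  obtains i where "i \<le> d" "(x, y) \<in> R i"
  using scheme_card[of x y] by (auto simp: card_1_singleton_iff)

lemma scheme_unique:
  assumes "i \<le> d" "j \<le> d" "(x, y) \<in> R i" "(x, y) \<in> R j"
  shows "i = j"
proof -
  obtain k where "{i. i \<le> d \<and> (x, y) \<in> R i} = {k}"
    using scheme_card[of x y] by (auto simp: card_1_singleton_iff)
  moreover have "i \<in> {i. i \<le> d \<and> (x, y) \<in> R i}" "j \<in> {i. i \<le> d \<and> (x, y) \<in> R i}"
    using assms by simp_all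
  ultimately show ?thesis
    by simp
qed

lemma scheme_disjoint: "F \<subseteq> {..d} \<Longrightarrow> disjoint_family_on R F"
  unfolding disjoint_family_on_def disjoint_iff split_paired_All
  by (metis atMost_iff scheme_unique subsetD)

lemma scheme_converse:
  assumes "i \<le> d"
  obtains j where "j \<le> d" "R j = (R i)\<inverse>"
proof -
  obtain j where j: "j \<le> d" "transpose (relation_matrix (R i)) = relation_matrix (R j)"
    using scheme assms by (auto simp: association_scheme_def)
  moreover have "transpose (relation_matrix (R i)) = relation_matrix ((R i)\<inverse>)"
    by (simp add: vec_eq_iff transpose_def)
  ultimately show ?thesis
    using that by (auto simp: relation_matrix_eq_iff)
qed

lemma scheme_converse_Union:
  assumes "F \<subseteq> {..d}"
  obtains G where "G \<subseteq> {..d}" "(\<Union>g\<in>G. R g) = (\<Union>f\<in>F. R f)\<inverse>"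
proof -
  have "\<exists>j. j \<le> d \<and> R j = (R f)\<inverse>" if "f \<in> F" for f
  proof -
    have "f \<le> d"
      using assms that by auto
    then show ?thesis
      by (rule scheme_converse) blast
  qed
  then obtain h where h: "\<And>f. f \<in> F \<Longrightarrow> h f \<le> d \<and> R (h f) = (R f)\<inverse>"
    by metis
  show ?thesis
    by (rule that[of "h ` F"]) (use h in \<open>auto simp: converse_UNION\<close>)
qed

text \<open>An entry of the sum counts the relations indexed by \<open>F\<close> that contain the
  pair; it is nonzero exactly when the pair lies in their union.\<close>

lemma scheme_Union_eq:
  assumes "F \<subseteq> {..d}" and "relation_matrix E = (\<Sum>f\<in>F. relation_matrix (R f))"
  shows "E = (\<Union>f\<in>F. R f)"
proof -
  have "(x, y) \<in> E \<longleftrightarrow> (\<exists>f\<in>F. (x, y) \<in> R f)" for x y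
  proof -
    have fin: "finite F"
      using assms(1) finite_subset by blast
    have "relation_matrix E $ x $ y = real (card (F \<inter> {f. (x, y) \<in> R f}))"
      using fin by (simp add: assms(2) sum.If_cases)
    then have "(x, y) \<in> E \<longleftrightarrow> F \<inter> {f. (x, y) \<in> R f} \<noteq> {}"
      using fin by (auto split: if_splits)
    then show ?thesis
      by blast
  qed
  then show ?thesis
    by auto
qed

section \<open>Intersection numbers as numbers of walks\<close>

context
  fixes p :: "nat \<Rightarrow> nat \<Rightarrow> nat \<Rightarrow> nat"
  assumes intersection: "intersection_numbers d R p"
begin

text \<open>Compare entries at \<open>(x, y)\<close> in the product formula: by uniqueness only the
  summand for \<open>k\<close> survives.\<close>

lemma card_walks:
  assumes "i \<le> d" "j \<le> d" "k \<le> d" "(x, y) \<in> R k"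
  shows "card {w. (x, w) \<in> R i \<and> (w, y) \<in> R j} = p i j k"
proof -
  have "real (card {w. (x, w) \<in> R i \<and> (w, y) \<in> R j}) =
      (relation_matrix (R i) ** relation_matrix (R j)) $ x $ y"
    by (simp add: relation_matrix_mult_nth)
  also have "\<dots> = (\<Sum>l\<le>d. real (p i j l) * (if (x, y) \<in> R l then 1 else 0))"
    using intersection assms by (simp add: intersection_numbers_def)
  also have "\<dots> = (\<Sum>l\<le>d. if l = k then real (p i j l) else 0)"
    using assms scheme_unique by (intro sum.cong) auto
  also have "\<dots> = real (p i j k)"
    using assms by simp
  finally show ?thesis
    by simp
qed

lemma card_walks_Union:
  assumes "F \<subseteq> {..d}" "G \<subseteq> {..d}" "k \<le> d" "(x, y) \<in> R k"
  shows "card {w. (x, w) \<in> (\<Union>f\<in>F. R f) \<and> (w, y) \<in> (\<Union>g\<in>G. R g)} =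
    (\<Sum>f\<in>F. \<Sum>g\<in>G. p f g k)"
proof -
  have "finite F" "finite G"
    using assms finite_subset by blast+
  then have "card {w. (x, w) \<in> (\<Union>f\<in>F. R f) \<and> (w, y) \<in> (\<Union>g\<in>G. R g)} =
      (\<Sum>f\<in>F. \<Sum>g\<in>G. card {w. (x, w) \<in> R f \<and> (w, y) \<in> R g})"
    using assms by (intro card_relcomp_Union scheme_disjoint)
  also have "\<dots> = (\<Sum>f\<in>F. \<Sum>g\<in>G. p f g k)"
    using assms by (intro sum.cong card_walks refl) auto
  finally show ?thesis .
qed

lemma intersection_number_commute:
  assumes "i \<le> d" "j \<le> d" "k \<le> d"
  shows "p i j k = p j i k"
proof -
  obtain x y where xy: "(x, y) \<in> R k"
    using scheme_nonempty[OF assms(3)] by auto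
  have "relation_matrix (R i) ** relation_matrix (R j) =
      relation_matrix (R j) ** relation_matrix (R i)"
    using scheme assms by (simp add: association_scheme_def)
  then have "(relation_matrix (R i) ** relation_matrix (R j)) $ x $ y =
      (relation_matrix (R j) ** relation_matrix (R i)) $ x $ y"
    by (rule arg_cong)
  then show ?thesis
    unfolding relation_matrix_mult_nth
    by (simp only: of_nat_eq_iff card_walks[OF assms(1,2,3) xy] card_walks[OF assms(2,1,3) xy])
qed

text \<open>Taking a step in the union and then a step in its converse, a closed walk at
  \<open>x\<close> is just a choice of an out-neighbour; in the other order, of an in-neighbour.
  Both degrees are thus coefficients at index 0, and commutativity equates them.\<close>

lemma scheme_regular:
  assumes "F \<subseteq> {..d}"
  obtains m where "\<And>x. card {y. (x, y) \<in> (\<Union>f\<in>F. R f)} = m"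
    and "\<And>x. card {y. (y, x) \<in> (\<Union>f\<in>F. R f)} = m"
proof -
  obtain G where G: "G \<subseteq> {..d}" "(\<Union>g\<in>G. R g) = (\<Union>f\<in>F. R f)\<inverse>"
    using assms scheme_converse_Union by blast
  have diag: "(x, x) \<in> R 0" for x
    by (simp add: scheme_0)
  have "card {y. (x, y) \<in> (\<Union>f\<in>F. R f)} = (\<Sum>f\<in>F. \<Sum>g\<in>G. p f g 0)" for x
    using card_walks_Union[OF assms G(1) _ diag, of x] unfolding G(2) by simp
  moreover have "card {y. (y, x) \<in> (\<Union>f\<in>F. R f)} = (\<Sum>g\<in>G. \<Sum>f\<in>F. p g f 0)" for x
    using card_walks_Union[OF G(1) assms _ diag, of x] unfolding G(2) by simp
  moreover have "(\<Sum>g\<in>G. \<Sum>f\<in>F. p g f 0) = (\<Sum>f\<in>F. \<Sum>g\<in>G. p f g 0)"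
    by (subst sum.swap, intro sum.cong refl intersection_number_commute) (use assms G in auto)
  ultimately show ?thesis
    using that by simp
qed

end

end

section \<open>The two Deza values and the equivalence\<close>

lemma card_le_2_imp_Min_Max:
  assumes "finite S" "S \<noteq> {}" "card S \<le> 2"
  shows "S \<subseteq> {Min S, Max S}"
proof (cases "Min S = Max S")
  case True
  show ?thesis
  proof
    fix s
    assume "s \<in> S"
    then have "Min S \<le> s" "s \<le> Max S"
      using assms(1) by simp_all
    then show "s \<in> {Min S, Max S}"
      using True by simp
  qed
next
  case False
  \<comment> \<open>Two distinct elements exhaust a set of at most two.\<close>
  then have "{Min S, Max S} = S"
    using assms by (intro card_seteq) auto
  then show ?thesis
    by simp
qed

theorem theorem3p4:
  fixes d :: nat
    and R :: "nat \<Rightarrow> ('x::finite) rel"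
    and p :: "nat \<Rightarrow> nat \<Rightarrow> nat \<Rightarrow> nat"
    and F :: "nat set"
    and D :: "'x pair_pre_digraph"
  assumes "association_scheme d R"
    and "intersection_numbers d R p"
    and "F \<subseteq> {1..d}"
    and "pverts D = UNIV"
    and "digraph_matrix D = (\<Sum>f\<in>F. relation_matrix (R f))"
  shows "deza_digraph D \<longleftrightarrow> card ((\<lambda>k. \<Sum>f\<in>F. \<Sum>g\<in>F. p f g k) ` {1..d}) \<le> 2"
proof -
  define c where "c k = (\<Sum>f\<in>F. \<Sum>g\<in>F. p f g k)" for k
  have F: "F \<subseteq> {..d}"
    using assms(3) by auto
  have E: "parcs D = (\<Union>f\<in>F. R f)"
    using scheme_Union_eq[OF assms(1) F] assms(5) by (simp add: digraph_matrix_def)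
  have walks: "card {w. (x, w) \<in> parcs D \<and> (w, y) \<in> parcs D} = c k"
    if "k \<le> d" "(x, y) \<in> R k" for x y k
    unfolding E c_def using card_walks_Union[OF assms(1,2) F F that] .
  have diag: "k = 0 \<longleftrightarrow> x = y" if "k \<le> d" "(x, y) \<in> R k" for x y k
    using scheme_0[OF assms(1)] scheme_unique[OF assms(1) that(1) _ that(2), of 0] that by auto
  have "deza_digraph D \<longleftrightarrow> card (c ` {1..d}) \<le> 2"
  proof
    assume "deza_digraph D"
    then obtain a b where ab:
      "\<And>x y. x \<noteq> y \<Longrightarrow> card {w. (x, w) \<in> parcs D \<and> (w, y) \<in> parcs D} \<in> {a, b}"
      using assms(4) by (auto simp: deza_digraph_def deza_digraph_with_def)
    have "c k \<in> {a, b}" if "k \<in> {1..d}" for k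
    proof -
      have "k \<le> d" "k \<noteq> 0"
        using that by auto
      \<comment> \<open>Nonemptiness of \<open>R k\<close> makes every index \<open>k\<close>
        visible to the Deza condition, through a pair of distinct points since \<open>k\<close> is
        not 0.\<close>
      obtain x y where xy: "(x, y) \<in> R k"
        using scheme_nonempty[OF assms(1) \<open>k \<le> d\<close>] by auto
      then have "x \<noteq> y"
        using diag \<open>k \<le> d\<close> \<open>k \<noteq> 0\<close> by blast
      from ab[OF this] show ?thesis
        by (simp only: walks[OF \<open>k \<le> d\<close> xy])
    qed
    then have "card (c ` {1..d}) \<le> card {a, b}"
      by (intro card_mono image_subsetI) simp_all
    also have "\<dots> \<le> 2"
      by (simp add: card_insert_if)
    finally show "card (c ` {1..d}) \<le> 2" .
  next
    assume card: "card (c ` {1..d}) \<le> 2"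
    obtain m where out: "\<And>x. card {y. (x, y) \<in> parcs D} = m"
      and inn: "\<And>x. card {y. (y, x) \<in> parcs D} = m"
      unfolding E by (rule scheme_regular[OF assms(1,2) F]) blast
    \<comment> \<open>Every middle vertex is an out-neighbour of \<open>x\<close>. This yields both
      parameter bounds, for \<open>b\<close> and for \<open>t\<close>, which will be
      \<open>c 0\<close>.\<close>
    have walks_le: "card {w. (x, w) \<in> parcs D \<and> (w, y) \<in> parcs D} \<le> m" for x y
      unfolding out[of x, symmetric] by (intro card_mono) auto
    have c_le: "c k \<le> m" if k: "k \<le> d" for k
    proof -
      obtain x y where "(x, y) \<in> R k"
        using scheme_nonempty[OF assms(1) k] by auto
      then show ?thesis
        using walks_le[of x y] by (simp only: walks[OF k])
    qed
    obtain a b where ab: "a \<le> b" "b \<le> m" "c ` {1..d} \<subseteq> {a, b}"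
    proof (cases "d = 0")
      case True
      \<comment> \<open>Here \<open>{1..d}\<close> is empty, so there are no values to cover; 0
        respects the bound by \<open>m\<close>.\<close>
      then show ?thesis
        using that[of 0 0] by simp
    next
      case False
      then have ne: "c ` {1..d} \<noteq> {}"
        by simp
      show ?thesis
      proof (rule that)
        show "Min (c ` {1..d}) \<le> Max (c ` {1..d})"
          by (intro Max_ge Min_in ne) simp_all
        show "Max (c ` {1..d}) \<le> m"
          using ne c_le by simp
        show "c ` {1..d} \<subseteq> {Min (c ` {1..d}), Max (c ` {1..d})}"
          using ne card by (intro card_le_2_imp_Min_Max) auto
      qed
    qed
    have no_loop: "(x, x) \<notin> parcs D" for x
    proof
      assume "(x, x) \<in> parcs D"
      then obtain f where "f \<in> F" "(x, x) \<in> R f"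
        unfolding E by blast
      then show False
        using diag[of f x x] assms(3) by auto
    qed
    have "pair_digraph D"
      by unfold_locales (use assms(4) no_loop in auto)
    moreover have "m \<le> card (UNIV :: 'x set)"
      unfolding out[of undefined, symmetric] by (intro card_mono) simp_all
    moreover have "c 0 \<le> m"
      by (simp add: c_le)
    moreover have "out_degree D v = m" "in_degree D v = m" for v
    proof -
      \<comment> \<open>The library degrees count arcs, whereas \<open>m\<close> counts neighbours;
        pairing with \<open>v\<close> is a bijection between the two.\<close>
      have "out_arcs D v = Pair v ` {y. (v, y) \<in> parcs D}"
        by (auto simp: out_arcs_def)
      then show "out_degree D v = m"
        by (simp add: out_degree_def card_image inj_on_def out)
      have "in_arcs D v = (\<lambda>y. (y, v)) ` {y. (y, v) \<in> parcs D}"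
        by (auto simp: in_arcs_def)
      then show "in_degree D v = m"
        by (simp add: in_degree_def card_image inj_on_def inn)
    qed
    \<comment> \<open>Vertices joined to \<open>v\<close> in both directions are the middle points
      of closed walks at \<open>v\<close>, and \<open>(v, v)\<close> lies in
      \<open>R 0\<close>.\<close>
    moreover have "card {u. (u, v) \<in> parcs D \<and> (v, u) \<in> parcs D} = c 0" for v
      using walks[of 0 v v] scheme_0[OF assms(1)] by (simp add: conj_commute)
    moreover have "card {w. (x, w) \<in> parcs D \<and> (w, y) \<in> parcs D} \<in> {a, b}" if "x \<noteq> y" for x y
    proof -
      obtain k where k: "k \<le> d" "(x, y) \<in> R k"
        using scheme_cover[OF assms(1)] .
      then have "k \<in> {1..d}"
        using diag[OF k] that by auto
      then have "c k \<in> {a, b}"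
        using ab(3) by blast
      then show ?thesis
        by (simp only: walks[OF k])
    qed
    ultimately have "deza_digraph_with (card (UNIV :: 'x set)) m b a (c 0) D"
      using ab(1,2) assms(4) by (simp add: deza_digraph_with_def)
    then show "deza_digraph D"
      unfolding deza_digraph_def by blast
  qed
  then show ?thesis
    by (simp add: c_def)
qed

end
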